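(* Let $D>2$ and $n\ge 1$ be integers and let $\alpha>1$ be a real number. Let $\mathcal{F}\subseteq \mathbb{Z}_D^n$ be a sunflower-free family in $\mathbb{Z}_D^n$. Then there exists a constant $K(\alpha)>0$, depending only on $\alpha$ (not on $D$, $n$ or $\mathcal{F}$), such that $$ |\mathcal{F}|\le K(\alpha)\, n!\left(\frac{(\log\log\log n)^2}{\alpha\log\log n}\right)^n . $$
   Context: Here $\mathbb{Z}_D=\mathbb{Z}/D\mathbb{Z}$ and $\log$ is the natural logarithm. Three distinct vectors $x,y,z\in \mathbb{Z}_D^n$ form a sunflower if for every coordinate $i\in\{1,\dots,n\}$ either $x_i=y_i=z_i$ or $x_i,y_i,z_i$ are pairwise different. A family $\mathcal{F}\subseteq \mathbb{Z}_D^n$ is sunflower-free if it contains no three distinct vectors forming a sunflower.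
   Formalization: The bound is stated for n ≥ 3 only, instead of n ≥ 1, because log log log n is not a real number for n = 1 (log log 1 = log 0) and n = 2 (log log 2 < 0). *)

theory Defs
  imports "HOL-Analysis.Analysis" "HOL-Number_Theory.Residues"
begin

text \<open>
  Vectors over the integers modulo \<open>D\<close>, with coordinates indexed by \<open>1, ..., n\<close>. The library
  represents each residue class by its representative in \<open>{0..D - 1}\<close>, so that equality of
  residue classes is equality of integers.
\<close>

definition residue_vectors :: "int \<Rightarrow> nat \<Rightarrow> (nat \<Rightarrow> int) set" where
  "residue_vectors D n = {1..n} \<rightarrow>\<^sub>E carrier (residue_ring D)"

definition sunflower :: "nat \<Rightarrow> (nat \<Rightarrow> 'a) \<Rightarrow> (nat \<Rightarrow> 'a) \<Rightarrow> (nat \<Rightarrow> 'a) \<Rightarrow> bool" where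
  "sunflower n x y z \<longleftrightarrow>
     x \<noteq> y \<and> y \<noteq> z \<and> x \<noteq> z \<and>
     (\<forall>i\<in>{1..n}. (x i = y i \<and> y i = z i) \<or> (x i \<noteq> y i \<and> y i \<noteq> z i \<and> x i \<noteq> z i))"

definition sunflower_free :: "nat \<Rightarrow> (nat \<Rightarrow> 'a) set \<Rightarrow> bool" where
  "sunflower_free n F \<longleftrightarrow> \<not> (\<exists>x\<in>F. \<exists>y\<in>F. \<exists>z\<in>F. sunflower n x y z)"

text \<open>
  The library makes \<open>ln\<close> total, with \<open>ln 0 = 0\<close>. The following predicate says that each
  logarithm in \<open>log (log (log x))\<close> is taken of a positive real, so that the expression is
  defined in the usual sense; for a natural number this means that it is at least \<open>3\<close>.
\<close>

definition triple_log_defined :: "real \<Rightarrow> bool" where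
  "triple_log_defined x \<longleftrightarrow> 0 < x \<and> 0 < ln x \<and> 0 < ln (ln x)"

lemma triple_log_defined_nat_iff: "triple_log_defined (real n) \<longleftrightarrow> 3 \<le> n"
proof
  assume "triple_log_defined (real n)"
  then have "0 < real n" "1 < ln (real n)"
    by (auto simp: triple_log_defined_def)
  then have "exp 1 < real n"
    by (metis exp_less_cancel_iff exp_ln)
  moreover have "2 \<le> exp (1::real)"
    using exp_ge_add_one_self[of 1] by simp
  ultimately show "3 \<le> n" by linarith
next
  assume "3 \<le> n"
  then have "ln 3 \<le> ln (real n)" by simp
  then have "1 < ln (real n)" using ln3_gt_1 by linarith
  then show "triple_log_defined (real n)"
    using \<open>3 \<le> n\<close> by (simp add: triple_log_defined_def)
qed

end

theory Submission
  imports Defs "HOL-Real_Asymp.Real_Asymp"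
begin

text \<open>
  A vector \<open>x\<close> is identified with its graph \<open>{(i, x i)}\<close>, so that sunflowers of vectors become
  sunflowers of \<open>n\<close>-element sets. Following Alweiss, Lovett, Wu and Zhang, it suffices to find three
  disjoint members in a family that is \<open>r\<close>-spread (at most a fraction \<open>r ^ -|U|\<close> of its members
  contain \<open>U\<close>): take the link of a set \<open>S\<close> that maximises \<open>r ^ |S|\<close> times the number of members
  containing \<open>S\<close>.

  Colour the ground set uniformly with six colours and group the colours into three pairs. For a
  pair \<open>a, b\<close>, first replace each member by a smallest set \<open>A j - W\<close> with \<open>A j\<close> inside the union of
  that member and the colour class \<open>W\<close> of \<open>a\<close>; by a counting argument in the style of Park and Pham,
  almost all of these fragments have size \<open>O(n / r)\<close>. Doing the same with \<open>b\<close> makes most fragments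
  empty as soon as \<open>r\<close> is a large multiple of \<open>n / r\<close>, that is, of \<open>sqrt n\<close>. So fewer than a third of
  the colourings have no member inside the classes of \<open>a\<close> and \<open>b\<close>, and some colouring works
  for all three pairs. This gives \<open>|F| \<le> (400 * sqrt n) ^ n\<close>, far below the claimed bound.
\<close>

section \<open>Minimal fragments of an indexed family\<close>

text \<open>Families are indexed, so members that coincide after trimming are still counted
  separately. For \<open>i \<in> I\<close> the choice \<open>j = i\<close> is admissible, so the
  minimum ranges over a nonempty collection.\<close>

definition fragment :: "'i set \<Rightarrow> ('i \<Rightarrow> 'a set) \<Rightarrow> 'a set \<Rightarrow> 'i \<Rightarrow> 'a set" where
  "fragment I A W i = arg_min card (\<lambda>V. \<exists>j\<in>I. A j \<subseteq> A i \<union> W \<and> V = A j - W)"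

lemma fragment_witness:
  assumes "i \<in> I"
  obtains j where "j \<in> I" "A j \<subseteq> A i \<union> W" "fragment I A W i = A j - W"
proof -
  have "\<exists>j\<in>I. A j \<subseteq> A i \<union> W \<and> A i - W = A j - W"
    using assms by blast
  from arg_min_natI[where P = "\<lambda>V. \<exists>j\<in>I. A j \<subseteq> A i \<union> W \<and> V = A j - W", OF this]
  show thesis using that unfolding fragment_def by blast
qed

lemma fragment_subset: "i \<in> I \<Longrightarrow> fragment I A W i \<subseteq> A i - W"
  by (erule fragment_witness[of i I A W]) blast

lemma card_fragment_le:
  assumes "j \<in> I" "A j \<subseteq> A i \<union> W"
  shows "card (fragment I A W i) \<le> card (A j - W)"
  unfolding fragment_def by (rule arg_min_nat_le) (use assms in blast)

text \<open>As \<open>A j\<close> lies in \<open>A i \<union> W\<close>, its remainder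
  \<open>A j - W\<close> competes in the minimum; being contained in the minimiser and no smaller
  than it, it is equal to it.\<close>

lemma fragment_eqI:
  assumes "i \<in> I" "finite (A i)" "j \<in> I" "A j \<subseteq> W \<union> fragment I A W i"
  shows "fragment I A W i = A j - W"
proof -
  have sub: "fragment I A W i \<subseteq> A i - W"
    using assms(1) by (rule fragment_subset)
  then have "finite (fragment I A W i)"
    using assms(2) finite_subset by fast
  moreover have "A j - W \<subseteq> fragment I A W i" using assms(4) by blast
  moreover have "card (fragment I A W i) \<le> card (A j - W)"
    using assms sub by (intro card_fragment_le) blast+
  ultimately show ?thesis by (metis card_seteq)
qed

section \<open>Counting colourings with large fragments\<close>

abbreviation colour_class :: "'a set \<Rightarrow> ('a \<Rightarrow> 'c) \<Rightarrow> 'c set \<Rightarrow> 'a set" where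
  "colour_class X \<kappa> K \<equiv> {x \<in> X. \<kappa> x \<in> K}"

text \<open>Used in both directions: a constant \<open>g\<close> erases the colours on
  \<open>T\<close>, and the restriction of the old colouring to \<open>T\<close> restores
  them.\<close>

definition recolour :: "'a set \<Rightarrow> ('a \<Rightarrow> 'c) \<Rightarrow> ('a \<Rightarrow> 'c) \<Rightarrow> 'a \<Rightarrow> 'c" where
  "recolour T g \<kappa> = (\<lambda>x. if x \<in> T then g x else \<kappa> x)"

text \<open>An infinite \<open>U\<close> has \<open>card U = 0\<close>, and the condition is then
  trivial for finite \<open>J\<close>.\<close>

definition spread :: "real \<Rightarrow> 'i set \<Rightarrow> ('i \<Rightarrow> 'a set) \<Rightarrow> bool" where
  "spread r J B \<longleftrightarrow> (\<forall>U. real (card {i \<in> J. U \<subseteq> B i}) * r ^ card U \<le> real (card J))"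

text \<open>Set up to serve both rounds. \<open>B\<close> is the fixed spread family;
  \<open>A \<kappa>\<close> holds its members as already trimmed under the colouring, and
  \<open>I \<kappa>\<close> the indices still in play. By \<open>inv\<close>, both can be read off
  the recoloured map.\<close>

locale fragment_count =
  fixes X :: "'a set" and C :: "'c set" and c :: 'c and r :: real and k :: nat
    and J :: "'i set" and B :: "'i \<Rightarrow> 'a set"
    and I :: "('a \<Rightarrow> 'c) \<Rightarrow> 'i set" and A :: "('a \<Rightarrow> 'c) \<Rightarrow> 'i \<Rightarrow> 'a set"
    and T :: "('a \<Rightarrow> 'c) \<Rightarrow> 'i \<Rightarrow> 'a set"
  defines "T \<equiv> \<lambda>\<kappa>. fragment (I \<kappa>) (A \<kappa>) (colour_class X \<kappa> {c})"
  assumes fin: "finite X" "finite C" "finite J" and c: "c \<in> C" and r: "r > 0"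
    and I: "\<And>\<kappa>. I \<kappa> \<subseteq> J"
    and A: "\<And>\<kappa> i. i \<in> I \<kappa> \<Longrightarrow> A \<kappa> i \<subseteq> B i"
    and k: "\<And>\<kappa> i. i \<in> I \<kappa> \<Longrightarrow> card (A \<kappa> i) \<le> k"
    and B: "\<And>i. i \<in> J \<Longrightarrow> B i \<subseteq> X"
    and inv: "\<And>\<kappa> i. \<lbrakk>\<kappa> \<in> X \<rightarrow>\<^sub>E C; i \<in> I \<kappa>\<rbrakk> \<Longrightarrow>
      I (recolour (T \<kappa> i) (\<lambda>_. c) \<kappa>) = I \<kappa> \<and> A (recolour (T \<kappa> i) (\<lambda>_. c) \<kappa>) = A \<kappa>"
    and spread: "spread r J B"
begin

text \<open>
  Recolouring the fragment \<open>V\<close> of \<open>i\<close> with the colour \<open>c\<close> loses little information: by minimality,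
  \<open>V\<close> lies in every member that is contained in the new colour class of \<open>c\<close>. Hence \<open>V\<close> is one of at
  most \<open>k choose t\<close> subsets of a member \<open>G \<psi>\<close> chosen from the new colouring \<open>\<psi>\<close> alone.
\<close>

lemma card_pairs_eq:
  "real (card {(\<kappa>, i). \<kappa> \<in> X \<rightarrow>\<^sub>E C \<and> i \<in> I \<kappa> \<and> card (T \<kappa> i) = t})
    \<le> real (card (X \<rightarrow>\<^sub>E C)) * real (card J) * (real (k choose t) * (real (card C - 1) / r) ^ t)"
proof -
  have finB: "finite (B i)" if "i \<in> J" for i
    using fin(1) B that finite_subset by blast
  \<comment> \<open>If some member lies in the class of \<open>c\<close>, \<open>G \<kappa>\<close>
    is such a member; otherwise it is an arbitrary finite set of size at most \<open>k\<close>, so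
    the count of its subsets is uniform in \<open>\<kappa>\<close>.\<close>
  define G where "G = (\<lambda>\<kappa>. SOME S. finite S \<and> card S \<le> k \<and>
    ((\<exists>j\<in>I \<kappa>. A \<kappa> j \<subseteq> colour_class X \<kappa> {c}) \<longrightarrow>
     (\<exists>j\<in>I \<kappa>. A \<kappa> j \<subseteq> colour_class X \<kappa> {c} \<and> S = A \<kappa> j)))"
  have G: "finite (G \<kappa>) \<and> card (G \<kappa>) \<le> k \<and>
    ((\<exists>j\<in>I \<kappa>. A \<kappa> j \<subseteq> colour_class X \<kappa> {c}) \<longrightarrow>
     (\<exists>j\<in>I \<kappa>. A \<kappa> j \<subseteq> colour_class X \<kappa> {c} \<and> G \<kappa> = A \<kappa> j))" for \<kappa>
    unfolding G_def
  proof (rule someI_ex)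
    show "\<exists>S. finite S \<and> card S \<le> k \<and>
      ((\<exists>j\<in>I \<kappa>. A \<kappa> j \<subseteq> colour_class X \<kappa> {c}) \<longrightarrow>
       (\<exists>j\<in>I \<kappa>. A \<kappa> j \<subseteq> colour_class X \<kappa> {c} \<and> S = A \<kappa> j))"
    proof (cases "\<exists>j\<in>I \<kappa>. A \<kappa> j \<subseteq> colour_class X \<kappa> {c}")
      case True
      then obtain j where j: "j \<in> I \<kappa>" "A \<kappa> j \<subseteq> colour_class X \<kappa> {c}" by blast
      moreover have "finite (A \<kappa> j)"
        using A[OF j(1)] finB I j(1) finite_subset by blast
      ultimately show ?thesis using k by blast
    qed (auto intro: exI[of _ "{}"])
  qed
  have finG: "finite (G \<kappa>)" and cardG: "card (G \<kappa>) \<le> k" for \<kappa>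
    using G[of \<kappa>] by blast+
  \<comment> \<open>Codes for the pairs: new colouring, fragment, index, and old colours on the
    fragment. The fragment avoids the old class of \<open>c\<close>, so each of its points had one
    of \<open>card C - 1\<close> colours.\<close>
  define S where "S = (SIGMA \<psi> : X \<rightarrow>\<^sub>E C. SIGMA V : {V. V \<subseteq> G \<psi> \<and> card V = t}.
    {i \<in> J. V \<subseteq> B i} \<times> (V \<rightarrow>\<^sub>E C - {c}))"
  have finV: "finite {V. V \<subseteq> G \<psi> \<and> card V = t}" for \<psi>
    using finG[of \<psi>] by (intro finite_subset[OF _ finite_Pow_iff[THEN iffD2, of "G \<psi>"]]) auto
  have finP: "finite ({i \<in> J. V \<subseteq> B i} \<times> (V \<rightarrow>\<^sub>E C - {c}))" if "V \<in> {V. V \<subseteq> G \<psi> \<and> card V = t}" for V \<psi>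
  proof -
    have "finite V" using that finG finite_subset by blast
    then show ?thesis using fin by (intro finite_cartesian_product finite_PiE) simp_all
  qed
  have finX: "finite (X \<rightarrow>\<^sub>E C)"
    using fin by (intro finite_PiE)
  have finS: "finite S"
    unfolding S_def by (intro finite_SigmaI finX finV finP)
  have "{(\<kappa>, i). \<kappa> \<in> X \<rightarrow>\<^sub>E C \<and> i \<in> I \<kappa> \<and> card (T \<kappa> i) = t}
      \<subseteq> (\<lambda>(\<psi>, V, i, g). (recolour V g \<psi>, i)) ` S"
  proof clarify
    fix \<kappa> i assume \<kappa>: "\<kappa> \<in> X \<rightarrow>\<^sub>E C" and i: "i \<in> I \<kappa>" and t: "t = card (T \<kappa> i)"
    define V where "V = T \<kappa> i"
    define \<psi> where "\<psi> = recolour V (\<lambda>_. c) \<kappa>"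
    define W where "W = colour_class X \<kappa> {c}"
    have V: "V = fragment (I \<kappa>) (A \<kappa>) W i"
      by (simp add: V_def T_def W_def)
    have Vsub: "V \<subseteq> A \<kappa> i - W"
      unfolding V using i by (rule fragment_subset)
    have AX: "A \<kappa> j \<subseteq> X" if "j \<in> I \<kappa>" for j
      using A I B that by (meson subset_trans subsetD)
    have VX: "V \<subseteq> X" using Vsub AX[OF i] by blast
    have \<psi>: "\<psi> \<in> X \<rightarrow>\<^sub>E C"
      using \<kappa> c VX unfolding \<psi>_def recolour_def by (auto simp: PiE_iff extensional_def)
    have inv': "I \<psi> = I \<kappa>" "A \<psi> = A \<kappa>"
      using inv[OF \<kappa> i] by (auto simp: \<psi>_def V_def)
    have cl: "colour_class X \<psi> {c} = W \<union> V"
      using VX by (auto simp: \<psi>_def recolour_def W_def)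
    obtain j where j: "j \<in> I \<kappa>" "V = A \<kappa> j - W"
      unfolding V using i by (rule fragment_witness)
    have "A \<kappa> j \<subseteq> W \<union> V"
      using j by blast
    then obtain l where l: "l \<in> I \<kappa>" "A \<kappa> l \<subseteq> W \<union> V" "G \<psi> = A \<kappa> l"
      using G[of \<psi>] j(1) unfolding cl inv' by blast
    have "finite (A \<kappa> i)"
      using AX[OF i] fin(1) finite_subset by blast
    with i l have "V = A \<kappa> l - W"
      unfolding V by (intro fragment_eqI)
    then have "V \<subseteq> G \<psi>" using l by blast
    moreover have "restrict \<kappa> V \<in> V \<rightarrow>\<^sub>E C - {c}"
      using \<kappa> Vsub VX unfolding W_def by (auto simp: PiE_iff)
    moreover have "i \<in> J" "V \<subseteq> B i"
      using i I A Vsub by blast+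
    ultimately have "(\<psi>, V, i, restrict \<kappa> V) \<in> S"
      unfolding S_def using \<psi> t V_def by auto
    moreover have "\<kappa> = recolour V (restrict \<kappa> V) \<psi>"
      unfolding \<psi>_def recolour_def by auto
    ultimately show "(\<kappa>, i) \<in> (\<lambda>(\<psi>, V, i, g). (recolour V g \<psi>, i)) ` S"
      by force
  qed
  then have "card {(\<kappa>, i). \<kappa> \<in> X \<rightarrow>\<^sub>E C \<and> i \<in> I \<kappa> \<and> card (T \<kappa> i) = t} \<le> card S"
    using finS surj_card_le by blast
  also have "card S = (\<Sum>\<psi>\<in>X \<rightarrow>\<^sub>E C. card (SIGMA V : {V. V \<subseteq> G \<psi> \<and> card V = t}.
      {i \<in> J. V \<subseteq> B i} \<times> (V \<rightarrow>\<^sub>E C - {c})))"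
    unfolding S_def by (intro card_SigmaI ballI finite_SigmaI finX finV finP)
  also have "\<dots> = (\<Sum>\<psi>\<in>X \<rightarrow>\<^sub>E C. \<Sum>V | V \<subseteq> G \<psi> \<and> card V = t.
      card {i \<in> J. V \<subseteq> B i} * card (V \<rightarrow>\<^sub>E C - {c}))"
    unfolding card_cartesian_product[symmetric] by (intro sum.cong refl card_SigmaI ballI finV finP)
  also have "real \<dots> \<le> (\<Sum>\<psi>\<in>X \<rightarrow>\<^sub>E C. \<Sum>V | V \<subseteq> G \<psi> \<and> card V = t.
      real (card J) * (real (card C - 1) / r) ^ t)"
    unfolding of_nat_sum
  proof (intro sum_mono, clarify)
    fix \<psi> V assume V: "V \<subseteq> G \<psi>" "t = card V"
    have "finite V" using V finG finite_subset by blast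
    then have "card (V \<rightarrow>\<^sub>E C - {c}) = (card C - 1) ^ card V"
      using c fin by (simp add: card_PiE)
    then have "real (card {i \<in> J. V \<subseteq> B i} * card (V \<rightarrow>\<^sub>E C - {c}))
      = real (card {i \<in> J. V \<subseteq> B i}) * real (card C - 1) ^ card V"
      by simp
    \<comment> \<open>Spreadness gains a factor \<open>r\<close> per point of \<open>V\<close>,
      against \<open>card C - 1\<close> possible old colours per point.\<close>
    also have "real (card {i \<in> J. V \<subseteq> B i}) \<le> real (card J) / r ^ card V"
      using spread r unfolding spread_def by (simp add: pos_le_divide_eq)
    finally show "real (card {i \<in> J. V \<subseteq> B i} * card (V \<rightarrow>\<^sub>E C - {c}))
      \<le> real (card J) * (real (card C - 1) / r) ^ card V"
      by (simp add: power_divide mult_right_mono)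
  qed
  also have "\<dots> \<le> (\<Sum>\<psi>\<in>X \<rightarrow>\<^sub>E C. real (k choose t) * (real (card J) * (real (card C - 1) / r) ^ t))"
  proof (intro sum_mono)
    fix \<psi>
    have "card {V. V \<subseteq> G \<psi> \<and> card V = t} = card (G \<psi>) choose t"
      using finG by (rule n_subsets)
    also have "\<dots> \<le> k choose t"
      using cardG by (rule binomial_right_mono)
    finally show "(\<Sum>V | V \<subseteq> G \<psi> \<and> card V = t. real (card J) * (real (card C - 1) / r) ^ t)
      \<le> real (k choose t) * (real (card J) * (real (card C - 1) / r) ^ t)"
      unfolding sum_constant using r by (intro mult_right_mono) simp_all
  qed
  finally show ?thesis by (simp add: mult_ac)
qed

lemma card_pairs_ge:
  "real (card {(\<kappa>, i). \<kappa> \<in> X \<rightarrow>\<^sub>E C \<and> i \<in> I \<kappa> \<and> m \<le> card (T \<kappa> i)})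
    \<le> real (card (X \<rightarrow>\<^sub>E C)) * real (card J) *
      (\<Sum>t=m..k. real (k choose t) * (real (card C - 1) / r) ^ t)"
proof -
  let ?P = "\<lambda>t. {(\<kappa>, i). \<kappa> \<in> X \<rightarrow>\<^sub>E C \<and> i \<in> I \<kappa> \<and> card (T \<kappa> i) = t}"
  have "card (T \<kappa> i) \<le> k" if "i \<in> I \<kappa>" for \<kappa> i
  proof -
    have "finite (A \<kappa> i)"
      using that A B I fin(1) by (meson finite_subset subsetD)
    moreover have "T \<kappa> i \<subseteq> A \<kappa> i - colour_class X \<kappa> {c}"
      unfolding T_def using that by (rule fragment_subset)
    then have "T \<kappa> i \<subseteq> A \<kappa> i" by blast
    ultimately have "card (T \<kappa> i) \<le> card (A \<kappa> i)" by (rule card_mono)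
    then show ?thesis using k[OF that] by (rule order_trans)
  qed
  then have "{(\<kappa>, i). \<kappa> \<in> X \<rightarrow>\<^sub>E C \<and> i \<in> I \<kappa> \<and> m \<le> card (T \<kappa> i)} = (\<Union>t\<in>{m..k}. ?P t)"
    by auto
  then have "card {(\<kappa>, i). \<kappa> \<in> X \<rightarrow>\<^sub>E C \<and> i \<in> I \<kappa> \<and> m \<le> card (T \<kappa> i)} \<le> (\<Sum>t=m..k. card (?P t))"
    by (simp add: card_UN_le)
  then have "real (card {(\<kappa>, i). \<kappa> \<in> X \<rightarrow>\<^sub>E C \<and> i \<in> I \<kappa> \<and> m \<le> card (T \<kappa> i)})
      \<le> (\<Sum>t=m..k. real (card (?P t)))"
    by (simp flip: of_nat_sum)
  also have "\<dots> \<le> (\<Sum>t=m..k. real (card (X \<rightarrow>\<^sub>E C)) * real (card J) *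
      (real (k choose t) * (real (card C - 1) / r) ^ t))"
    by (intro sum_mono card_pairs_eq)
  finally show ?thesis by (simp add: sum_distrib_left)
qed

end

section \<open>Numerical estimates for the two rounds\<close>

text \<open>For \<open>t \<ge> m\<close> the factor \<open>2 ^ t / 2 ^ m\<close> is at least 1;
  inserting it and extending the sum to all \<open>t\<close> gives the binomial expansion of
  \<open>(1 + 2 * y) ^ k\<close>.\<close>

lemma binomial_tail_le:
  fixes y :: real
  assumes "y \<ge> 0"
  shows "(\<Sum>t=m..k. real (k choose t) * y ^ t) \<le> (1 + 2 * y) ^ k / 2 ^ m"
proof -
  have "(\<Sum>t=m..k. real (k choose t) * y ^ t) \<le> (\<Sum>t=m..k. real (k choose t) * (2 * y) ^ t / 2 ^ m)"
  proof (rule sum_mono)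
    fix t assume "t \<in> {m..k}"
    then have "real (k choose t) * y ^ t * 2 ^ m \<le> real (k choose t) * y ^ t * 2 ^ t"
      using assms by (intro mult_left_mono power_increasing) auto
    then show "real (k choose t) * y ^ t \<le> real (k choose t) * (2 * y) ^ t / 2 ^ m"
      by (simp add: field_simps power_mult_distrib)
  qed
  also have "\<dots> \<le> (\<Sum>t\<le>k. real (k choose t) * (2 * y) ^ t / 2 ^ m)"
    using assms by (intro sum_mono2) auto
  also have "\<dots> = (1 + 2 * y) ^ k / 2 ^ m"
    using binomial_ring[of "2 * y" 1 k] by (simp add: sum_divide_distrib add.commute)
  finally show ?thesis .
qed

lemma binomial_tail_from_1:
  fixes y :: real
  shows "(\<Sum>t=1..k. real (k choose t) * y ^ t) = (1 + y) ^ k - 1"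
  using binomial_ring[of y 1 k] by (simp add: sum.atMost_shift add.commute sum.atLeast1_atMost_eq)

text \<open>Here \<open>5 / (200 * s)\<close> is \<open>(card C - 1) / r\<close> for six colours,
  and \<open>4 * s\<close> is the size below which first fragments are kept. What matters is
  \<open>1 / 8 + 1 / 5 < 1 / 3\<close>.\<close>

lemma step_bounds:
  fixes n s :: nat
  assumes "s \<ge> 1" "n \<le> s ^ 2"
  shows "(1 + 2 * (5 / (200 * real s))) ^ n / 2 ^ (4 * s) \<le> 1 / 8"
    and "(1 + 5 / (200 * real s)) ^ (4 * s) - 1 \<le> 1 / 5"
proof -
  have n: "real n / (20 * real s) \<le> real s / 20"
    using assms by (simp add: field_simps power2_eq_square flip: of_nat_mult)
  have "(1 + 2 * (5 / (200 * real s))) ^ n \<le> exp (1 / (20 * real s)) ^ n"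
    using exp_ge_add_one_self[of "1 / (20 * real s)"] assms by (intro power_mono) auto
  also have "\<dots> = exp (real n / (20 * real s))"
    by (simp flip: exp_of_nat_mult)
  also have "\<dots> \<le> exp (real s / 20)"
    using n by simp
  also have "\<dots> \<le> exp (ln 2 * real s)"
    using ln2_ge_two_thirds assms by (simp add: field_simps)
  also have "\<dots> = 2 ^ s"
    by (simp add: exp_of_nat2_mult)
  finally have "(1 + 2 * (5 / (200 * real s))) ^ n / 2 ^ (4 * s) \<le> 2 ^ s / 2 ^ (4 * s)"
    by (intro divide_right_mono) auto
  also have "\<dots> = 1 / 8 ^ s"
  proof -
    have "(2::real) ^ (4 * s) = (2 * 8) ^ s" by (simp add: power_mult)
    then have "(2::real) ^ (4 * s) = 2 ^ s * 8 ^ s" by (simp only: power_mult_distrib)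
    then show ?thesis by simp
  qed
  also have "\<dots> \<le> 1 / 8"
    using assms self_le_power[of "8::real" s] by (intro divide_left_mono) auto
  finally show "(1 + 2 * (5 / (200 * real s))) ^ n / 2 ^ (4 * s) \<le> 1 / 8" .
  have "(1 + 5 / (200 * real s)) ^ (4 * s) \<le> exp (1 / (40 * real s)) ^ (4 * s)"
    using exp_ge_add_one_self[of "1 / (40 * real s)"] assms by (intro power_mono) auto
  also have "\<dots> = exp (1 / 10)"
    using assms by (simp flip: exp_of_nat_mult)
  also have "\<dots> \<le> 6 / 5"
  \<comment> \<open>\<open>exp (-1/10) \<ge> 9/10\<close> gives
    \<open>exp (1/10) \<le> 10/9\<close>.\<close>
  proof -
    have "9 / 10 * exp (1 / 10) \<le> exp (-1/10) * exp (1 / 10 :: real)"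
      using exp_ge_add_one_self[of "-1/10 :: real"] by (intro mult_right_mono) auto
    also have "\<dots> = 1" by (simp flip: exp_add)
    finally show ?thesis by simp
  qed
  finally show "(1 + 5 / (200 * real s)) ^ (4 * s) - 1 \<le> 1 / 5" by simp
qed

section \<open>Two rounds of fragments for a pair of colours\<close>

text \<open>
  The second step is applied to the fragments of the first. Its recolouring to \<open>b\<close> only touches
  points outside the colour class of \<open>a\<close>, so it leaves the first fragments unchanged.
\<close>

lemma card_colourings_missing:
  fixes B :: "'i \<Rightarrow> 'a set" and C :: "'c set"
  assumes fin: "finite X" "finite J" "J \<noteq> {}"
    and B: "\<And>i. i \<in> J \<Longrightarrow> B i \<subseteq> X" "\<And>i. i \<in> J \<Longrightarrow> card (B i) \<le> n"
    and s: "s \<ge> 1" "n \<le> s ^ 2" and spread: "spread (200 * real s) J B"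
    and C: "card C = 6" "a \<in> C" "b \<in> C" "a \<noteq> b"
  shows "3 * card {\<kappa> \<in> X \<rightarrow>\<^sub>E C. \<not> (\<exists>i\<in>J. B i \<subseteq> colour_class X \<kappa> {a, b})} < card (X \<rightarrow>\<^sub>E C)"
proof -
  have finC: "finite C" using C(1) card.infinite by fastforce
  let ?r = "200 * real s"
  define W where "W = (\<lambda>c (\<kappa> :: 'a \<Rightarrow> 'c). colour_class X \<kappa> {c})"
  define T1 where "T1 = (\<lambda>\<kappa>. fragment J B (W a \<kappa>))"
  \<comment> \<open>Only small first fragments enter the second round; the others are charged to
    \<open>?P1\<close>.\<close>
  define I where "I = (\<lambda>\<kappa>. {i \<in> J. card (T1 \<kappa> i) < 4 * s})"
  define T2 where "T2 = (\<lambda>\<kappa>. fragment (I \<kappa>) (T1 \<kappa>) (W b \<kappa>))"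
  have T1: "T1 \<kappa> i \<subseteq> B i - W a \<kappa>" if "i \<in> J" for \<kappa> i
    unfolding T1_def using that by (rule fragment_subset)
  have T2: "T2 \<kappa> i \<subseteq> T1 \<kappa> i - W b \<kappa>" if "i \<in> I \<kappa>" for \<kappa> i
    unfolding T2_def using that by (rule fragment_subset)
  interpret step1: fragment_count X C a ?r n J B "\<lambda>_. J" "\<lambda>_. B" T1
    by unfold_locales (use fin finC C B s spread in \<open>auto simp: T1_def W_def\<close>)
  have Wa: "W a (recolour (T2 \<kappa> i) (\<lambda>_. b) \<kappa>) = W a \<kappa>" if "i \<in> I \<kappa>" for \<kappa> i
    using T2[OF that] T1[of i \<kappa>] that C unfolding I_def W_def recolour_def by auto
  have inv: "I (recolour (T2 \<kappa> i) (\<lambda>_. b) \<kappa>) = I \<kappa> \<and> T1 (recolour (T2 \<kappa> i) (\<lambda>_. b) \<kappa>) = T1 \<kappa>"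
    if "i \<in> I \<kappa>" for \<kappa> i
    unfolding I_def T1_def Wa[OF that] by simp
  have T1_sub: "T1 \<kappa> i \<subseteq> B i" if "i \<in> I \<kappa>" for \<kappa> i
    using T1[of i \<kappa>] that unfolding I_def by blast
  interpret step2: fragment_count X C b ?r "4 * s" J B I T1 T2
    by (unfold_locales; (erule inv[unfolded T2_def W_def] T1_sub)?)
      (use fin finC C B s spread in \<open>auto simp: T2_def I_def W_def\<close>)
  define N where "N = card (X \<rightarrow>\<^sub>E C)"
  have "N > 0" unfolding N_def using fin finC C by (simp add: card_PiE prod_pos)
  define M where "M = {\<kappa> \<in> X \<rightarrow>\<^sub>E C. \<not> (\<exists>i\<in>J. B i \<subseteq> colour_class X \<kappa> {a, b})}"
  let ?P1 = "{(\<kappa>, i). \<kappa> \<in> X \<rightarrow>\<^sub>E C \<and> i \<in> J \<and> 4 * s \<le> card (T1 \<kappa> i)}"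
  let ?P2 = "{(\<kappa>, i). \<kappa> \<in> X \<rightarrow>\<^sub>E C \<and> i \<in> I \<kappa> \<and> 1 \<le> card (T2 \<kappa> i)}"
  \<comment> \<open>For a colouring in \<open>M\<close> every index is bad. If the first fragment of
    \<open>i\<close> were small and the second empty, the second witness \<open>j\<close> would have
    \<open>T1 \<kappa> j\<close> inside the class of \<open>b\<close>, and the first witness
    \<open>l\<close> for \<open>j\<close> would put \<open>B l\<close> into the two classes.\<close>
  have "M \<times> J \<subseteq> ?P1 \<union> ?P2"
  proof
    fix p assume "p \<in> M \<times> J"
    then obtain \<kappa> i where p: "p = (\<kappa>, i)" and \<kappa>: "\<kappa> \<in> M" and i: "i \<in> J" by blast
    have \<kappa>X: "\<kappa> \<in> X \<rightarrow>\<^sub>E C" using \<kappa> unfolding M_def by blast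
    show "p \<in> ?P1 \<union> ?P2"
    proof (rule ccontr)
      assume np: "p \<notin> ?P1 \<union> ?P2"
      then have iI: "i \<in> I \<kappa>"
        using p i \<kappa>X by (simp add: I_def)
      then have "card (T2 \<kappa> i) = 0"
        using np p \<kappa>X by simp
      moreover have "finite (T2 \<kappa> i)"
        using T2[OF iI] T1[OF i, of \<kappa>] B(1)[OF i] fin(1) by (meson Diff_subset finite_subset order_trans)
      ultimately have "T2 \<kappa> i = {}" by simp
      moreover obtain j where j: "j \<in> I \<kappa>" "T2 \<kappa> i = T1 \<kappa> j - W b \<kappa>"
        unfolding T2_def using iI by (rule fragment_witness)
      moreover have "j \<in> J" using j(1) by (simp add: I_def)
      then obtain l where l: "l \<in> J" "T1 \<kappa> j = B l - W a \<kappa>"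
        unfolding T1_def by (rule fragment_witness)
      ultimately have "B l \<subseteq> W a \<kappa> \<union> W b \<kappa>" by blast
      then have "B l \<subseteq> colour_class X \<kappa> {a, b}" unfolding W_def by blast
      then show False using \<kappa> l(1) unfolding M_def by blast
    qed
  qed
  moreover have "finite (?P1 \<union> ?P2)"
    by (rule finite_subset[of _ "(X \<rightarrow>\<^sub>E C) \<times> J"]) (use fin finC in \<open>auto simp: I_def finite_PiE\<close>)
  ultimately have "card (M \<times> J) \<le> card ?P1 + card ?P2"
    by (meson card_mono card_Un_le order_trans)
  then have "real (card M) * real (card J) \<le> real (card ?P1) + real (card ?P2)"
    by (simp add: card_cartesian_product flip: of_nat_mult of_nat_add)
  \<comment> \<open>Round one is a binomial tail from \<open>4 * s\<close> over sets of size at most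
    \<open>n\<close>, round two a tail from 1 over sets of size at most \<open>4 * s\<close>.
    Together they give \<open>13 / 40\<close>, just below a third.\<close>
  also have "\<dots> \<le> real N * real (card J) * (1 / 8) + real N * real (card J) * (1 / 5)"
  proof (intro add_mono)
    have "real (card ?P1) \<le> real N * real (card J) * (\<Sum>t=(4 * s)..n. real (n choose t) * (5 / ?r) ^ t)"
      using step1.card_pairs_ge[of "4 * s"] C by (simp add: N_def)
    also have "(\<Sum>t=(4 * s)..n. real (n choose t) * (5 / ?r) ^ t) \<le> 1 / 8"
      by (rule order_trans[OF binomial_tail_le step_bounds(1)[OF s]]) simp
    finally show "real (card ?P1) \<le> real N * real (card J) * (1 / 8)"
      by (simp add: mult_left_mono)
    have "real (card ?P2) \<le> real N * real (card J) * (\<Sum>t=1..(4 * s). real (4 * s choose t) * (5 / ?r) ^ t)"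
      using step2.card_pairs_ge[of 1] C by (simp add: N_def)
    also have "(\<Sum>t=1..(4 * s). real (4 * s choose t) * (5 / ?r) ^ t) \<le> 1 / 5"
      unfolding binomial_tail_from_1 by (rule step_bounds(2)[OF s])
    finally show "real (card ?P2) \<le> real N * real (card J) * (1 / 5)"
      by (simp add: mult_left_mono)
  qed
  also have "\<dots> = (13 / 40 * real N) * real (card J)"
    by simp
  finally have "real (card M) \<le> 13 / 40 * real N"
    using fin by (simp add: card_gt_0_iff)
  then have "3 * card M < N"
    using \<open>N > 0\<close> by linarith
  then show ?thesis by (simp add: M_def N_def)
qed

section \<open>From spread families to sunflowers of sets\<close>

text \<open>By the union bound some colouring is good for the pairs 01, 23 and 45, whose classes are
  disjoint. The indices may coincide, as an empty \<open>B i\<close> could serve three times; the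
  application has to rule this out.\<close>

lemma spread_imp_three_disjoint:
  fixes B :: "'i \<Rightarrow> 'a set"
  assumes J: "finite J" "J \<noteq> {}"
    and B: "\<And>i. i \<in> J \<Longrightarrow> finite (B i)" "\<And>i. i \<in> J \<Longrightarrow> card (B i) \<le> n"
    and s: "s \<ge> 1" "n \<le> s ^ 2" and spread: "spread (200 * real s) J B"
  obtains i j k where "i \<in> J" "j \<in> J" "k \<in> J"
    "B i \<inter> B j = {}" "B j \<inter> B k = {}" "B i \<inter> B k = {}"
proof -
  define X where "X = \<Union> (B ` J)"
  define C where "C = {..<6::nat}"
  define M where "M = (\<lambda>a b. {\<kappa> \<in> X \<rightarrow>\<^sub>E C. \<not> (\<exists>i\<in>J. B i \<subseteq> colour_class X \<kappa> {a, b})})"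
  have X: "finite X" using J B by (simp add: X_def)
  have M: "3 * card (M a b) < card (X \<rightarrow>\<^sub>E C)" if "a \<in> C" "b \<in> C" "a \<noteq> b" for a b
    unfolding M_def
    by (rule card_colourings_missing[OF X J _ B(2) s spread]) (use that in \<open>auto simp: C_def X_def\<close>)
  have "finite (X \<rightarrow>\<^sub>E C)" using X by (simp add: C_def finite_PiE)
  then have finM: "finite (M a b)" for a b by (simp add: M_def)
  have "card (M 0 1 \<union> M 2 3 \<union> M 4 5) \<le> card (M 0 1) + card (M 2 3) + card (M 4 5)"
    by (meson add_le_mono1 card_Un_le order_trans)
  also have "\<dots> < card (X \<rightarrow>\<^sub>E C)"
    using M[of 0 1] M[of 2 3] M[of 4 5] by (simp add: C_def)
  finally have "\<not> X \<rightarrow>\<^sub>E C \<subseteq> M 0 1 \<union> M 2 3 \<union> M 4 5"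
    using finM by (meson card_mono finite_UnI leD)
  then obtain \<kappa> where \<kappa>: "\<kappa> \<in> X \<rightarrow>\<^sub>E C" "\<kappa> \<notin> M 0 1" "\<kappa> \<notin> M 2 3" "\<kappa> \<notin> M 4 5"
    by blast
  obtain i where i: "i \<in> J" "B i \<subseteq> colour_class X \<kappa> {0, 1}"
    using \<kappa> unfolding M_def by blast
  obtain j where j: "j \<in> J" "B j \<subseteq> colour_class X \<kappa> {2, 3}"
    using \<kappa> unfolding M_def by blast
  obtain k where k: "k \<in> J" "B k \<subseteq> colour_class X \<kappa> {4, 5}"
    using \<kappa> unfolding M_def by blast
  show thesis
    by (rule that[OF i(1) j(1) k(1)]) (use i(2) j(2) k(2) in fastforce)+
qed

theorem sunflower_of_large_family:
  fixes H :: "'a set set"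
  assumes H: "finite H" "\<And>A. A \<in> H \<Longrightarrow> finite A" "\<And>A. A \<in> H \<Longrightarrow> card A = n"
    and s: "s \<ge> 1" "n \<le> s ^ 2" and large: "card H > (200 * s) ^ n"
  obtains A B C S where "A \<in> H" "B \<in> H" "C \<in> H" "A \<noteq> B" "B \<noteq> C" "A \<noteq> C"
    "A \<inter> B = S" "B \<inter> C = S" "A \<inter> C = S"
proof -
  define r where "r = 200 * s"
  have r: "r > 0" using s by (simp add: r_def)
  \<comment> \<open>The value at \<open>{}\<close> is \<open>card H\<close>, so the maximum exceeds
    \<open>r ^ n\<close>.\<close>
  define f where "f = (\<lambda>S. card {A \<in> H. S \<subseteq> A} * r ^ card S)"
  have fin: "finite (f ` Pow (\<Union> H))" using H by simp
  have "Max (f ` Pow (\<Union> H)) \<in> f ` Pow (\<Union> H)"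
    using fin by (intro Max_in) auto
  then obtain S where S: "S \<subseteq> \<Union> H" "f S = Max (f ` Pow (\<Union> H))" by auto
  have max: "f U \<le> f S" if "U \<subseteq> \<Union> H" for U
    unfolding S(2) using fin that by (intro Max_ge) auto
  have "f {} \<le> f S" by (rule max) simp
  then have fS: "r ^ n < f S" using large by (simp add: f_def r_def)
  define L where "L = {A \<in> H. S \<subseteq> A}"
  have "card L \<noteq> 0" using fS by (intro notI) (simp add: f_def L_def)
  then have L: "finite L" "L \<noteq> {}" by (auto simp: card_eq_0_iff)
  \<comment> \<open>A member equal to \<open>S\<close> would be the only one containing
    \<open>S\<close>, as all have size \<open>n\<close>, giving \<open>f S \<le> r ^ n\<close>. So
    the sets \<open>A - S\<close> are nonempty, and disjoint ones come from distinct
    members.\<close>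
  have neq: "A \<noteq> S" if "A \<in> L" for A
  proof
    assume "A = S"
    then have cS: "card S = n" using that H by (simp add: L_def)
    have "L \<subseteq> {S}"
    proof
      fix B assume "B \<in> L"
      then have "finite B" "S \<subseteq> B" "card S = card B" using H cS by (auto simp: L_def)
      then have "S = B" by (rule card_subset_eq)
      then show "B \<in> {S}" by simp
    qed
    then have "card L \<le> 1" using card_mono[of "{S}" L] by simp
    then have "f S \<le> r ^ n" by (simp add: f_def cS flip: L_def)
    with fS show False by simp
  qed
  have spread: "spread (200 * real s) L (\<lambda>A. A - S)"
    unfolding spread_def
  proof
    fix U
    \<comment> \<open>A member with \<open>U \<subseteq> A - S\<close> makes \<open>U\<close> finite
      and disjoint from \<open>S\<close>, so the sizes add; compare \<open>f (S \<union> U)\<close>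
      with the maximum and cancel \<open>r ^ card S\<close>.\<close>
    have "card {A \<in> L. U \<subseteq> A - S} * r ^ card U \<le> card L"
    proof (cases "{A \<in> L. U \<subseteq> A - S} = {}")
      case False
      then obtain A where A: "A \<in> L" "U \<subseteq> A - S" by blast
      then have finA: "finite A" and sub: "S \<union> U \<subseteq> A" "A \<in> H" using H by (auto simp: L_def)
      have "finite S" "finite U"
        using sub finA by (auto intro: finite_subset)
      then have c: "card (S \<union> U) = card S + card U"
        using A by (intro card_Un_disjoint) auto
      have "f (S \<union> U) \<le> f S" using sub by (intro max) blast
      moreover have "{A \<in> L. U \<subseteq> A - S} = {A \<in> H. S \<union> U \<subseteq> A}"
        using A by (auto simp: L_def)
      ultimately have "(card {A \<in> L. U \<subseteq> A - S} * r ^ card U) * r ^ card S \<le> card L * r ^ card S"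
        by (simp add: f_def c power_add mult_ac flip: L_def)
      then show ?thesis using r by simp
    next
      case True
      then show ?thesis by (simp only: True card.empty)
    qed
    then have "real (card {A \<in> L. U \<subseteq> A - S} * r ^ card U) \<le> real (card L)"
      by (simp only: of_nat_le_iff)
    then show "real (card {A \<in> L. U \<subseteq> A - S}) * (200 * real s) ^ card U \<le> real (card L)"
      by (simp add: r_def)
  qed
  have "finite (A - S)" "card (A - S) \<le> n" if "A \<in> L" for A
    using that H by (auto simp: L_def card_mono[of A "A - S"] intro!: order_trans[OF card_mono[of A "A - S"]])
  from spread_imp_three_disjoint[OF L this s spread]
  obtain A B C where ABC: "A \<in> L" "B \<in> L" "C \<in> L"
    "(A - S) \<inter> (B - S) = {}" "(B - S) \<inter> (C - S) = {}" "(A - S) \<inter> (C - S) = {}"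
    by metis
  have sub: "S \<subseteq> A" "S \<subseteq> B" "S \<subseteq> C" "A \<in> H" "B \<in> H" "C \<in> H"
    using ABC by (auto simp: L_def)
  show thesis
    by (rule that[of A B C S]) (use sub ABC neq[OF ABC(1)] neq[OF ABC(2)] in blast)+
qed

section \<open>Sunflower-free families of vectors\<close>

lemma card_sunflower_free_le:
  fixes F :: "(nat \<Rightarrow> 'a) set"
  assumes F: "finite F" "F \<subseteq> extensional {1..n}" "sunflower_free n F"
    and s: "s \<ge> 1" "n \<le> s ^ 2"
  shows "card F \<le> (200 * s) ^ n"
proof (rule ccontr)
  assume large: "\<not> card F \<le> (200 * s) ^ n"
  define g where "g = (\<lambda>x :: nat \<Rightarrow> 'a. (\<lambda>i. (i, x i)) ` {1..n})"
  have mem: "(i, v) \<in> g x \<longleftrightarrow> i \<in> {1..n} \<and> v = x i" for i v x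
    by (auto simp: g_def)
  \<comment> \<open>Extensional functions agree outside \<open>{1..n}\<close>, so the graph
    determines the vector.\<close>
  have "inj_on g F"
  proof (rule inj_onI)
    fix x y assume xy: "x \<in> F" "y \<in> F" "g x = g y"
    then have "x i = y i" if "i \<in> {1..n}" for i using mem[of i "x i"] that by blast
    then show "x = y" using xy F(2) by (meson extensionalityI subsetD)
  qed
  then have "card (g ` F) = card F" by (rule card_image)
  moreover have "finite (g ` F)" using F by simp
  moreover have "finite A" "card A = n" if "A \<in> g ` F" for A
    using that by (auto simp: g_def card_image inj_on_def)
  moreover have "(200 * s) ^ n < card F" using large by simp
  ultimately obtain A B C S where ABC: "A \<in> g ` F" "B \<in> g ` F" "C \<in> g ` F"
    "A \<noteq> B" "B \<noteq> C" "A \<noteq> C" "A \<inter> B = S" "B \<inter> C = S" "A \<inter> C = S"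
    using s by (elim sunflower_of_large_family[of "g ` F" n s, rotated -1]) simp_all
  then obtain x y z where xyz: "x \<in> F" "y \<in> F" "z \<in> F" "A = g x" "B = g y" "C = g z"
    by blast
  \<comment> \<open>For \<open>i\<close> in \<open>{1..n}\<close>, \<open>(i, x i)\<close> lies in
    \<open>g y\<close> iff \<open>x i = y i\<close>; equal pairwise intersections thus mean that at
    each coordinate one equality forces the others.\<close>
  have "g x \<inter> g y = g y \<inter> g z" "g x \<inter> g z = g y \<inter> g z"
    using ABC xyz by simp_all
  then have "(x i = y i \<longleftrightarrow> y i = z i) \<and> (x i = z i \<longleftrightarrow> y i = z i)" if "i \<in> {1..n}" for i
    using mem[of i] that by (metis Int_iff)
  then have "sunflower n x y z"
    unfolding sunflower_def using ABC xyz by metis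
  then show False
    using F(3) xyz unfolding sunflower_free_def by blast
qed

lemma card_sunflower_free_le_sqrt:
  fixes F :: "(nat \<Rightarrow> 'a) set"
  assumes "finite F" "F \<subseteq> extensional {1..n}" "sunflower_free n F" "n \<ge> 1"
  shows "real (card F) \<le> (400 * sqrt (real n)) ^ n"
proof -
  \<comment> \<open>Rounding up gives \<open>n \<le> s ^ 2\<close>; as \<open>n \<ge> 1\<close>,
    \<open>s\<close> is at most \<open>2 * sqrt n\<close>, which turns 200 into 400.\<close>
  define s where "s = nat \<lceil>sqrt (real n)\<rceil>"
  have sn: "sqrt (real n) \<le> real s" "real s \<le> sqrt (real n) + 1"
    using of_nat_ceiling[of "sqrt (real n)"] of_int_ceiling_le_add_one[of "sqrt (real n)"]
    by (simp_all add: s_def)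
  have "1 \<le> sqrt (real n)" using assms(4) by simp
  then have s1: "s \<ge> 1" using sn by linarith
  have "(sqrt (real n))\<^sup>2 \<le> (real s)\<^sup>2" using sn by (intro power_mono) auto
  then have "real n \<le> real (s\<^sup>2)" by simp
  then have "card F \<le> (200 * s) ^ n"
    using assms s1 by (intro card_sunflower_free_le) (simp_all only: of_nat_le_iff)
  then have "real (card F) \<le> real ((200 * s) ^ n)" by (simp only: of_nat_le_iff)
  also have "\<dots> = (200 * real s) ^ n" by simp
  also have "\<dots> \<le> (400 * sqrt (real n)) ^ n"
  proof (rule power_mono)
    show "200 * real s \<le> 400 * sqrt (real n)" using sn \<open>1 \<le> sqrt (real n)\<close> by linarith
  qed simp
  finally show ?thesis .
qed

section \<open>Comparison with the triple-logarithmic bound\<close>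

text \<open>\<open>n ^ n / fact n\<close> is a single term of the series for
  \<open>exp n\<close>.\<close>

lemma power_div_exp_le_fact: "(real n / exp 1) ^ n \<le> fact n"
proof -
  have "real n ^ n / fact n \<le> (\<Sum>k. real n ^ k /\<^sub>R fact k)"
    using sum_le_suminf[OF summable_exp_generic[of "real n"], of "{n}"] by (simp add: field_simps)
  also have "\<dots> = exp (real n)" by (simp add: exp_def)
  also have "\<dots> = exp 1 ^ n" by (simp flip: exp_of_nat_mult)
  finally show ?thesis by (simp add: field_simps)
qed

text \<open>The right-hand side of the theorem would vanish at \<open>n = exp (exp 1)\<close>, which lies between 15 and 16.\<close>

lemma ln_ln_ln_nat_neq_0:
  assumes "n \<ge> 3"
  shows "ln (ln (ln (real n))) \<noteq> 0"
proof
  assume 0: "ln (ln (ln (real n))) = 0"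
  have pos: "0 < real n" "0 < ln (real n)" "0 < ln (ln (real n))"
    using assms triple_log_defined_nat_iff[of n] by (auto simp: triple_log_defined_def)
  then have "ln (ln (real n)) = 1" using 0 by (metis exp_ln exp_zero)
  then have "ln (real n) = exp 1" using pos by (metis exp_ln)
  then have n: "real n = exp (exp 1)" using pos by (metis exp_ln)
  have "exp (exp 1) < (16::real)"
  proof -
    \<comment> \<open>Split 2.72 as \<open>2 + 8 * 0.09\<close>, so that
      \<open>1 + x + x ^ 2\<close> bounds \<open>exp x\<close> sharply enough at 0.09.\<close>
    have "exp (exp 1 :: real) \<le> exp (2 + 8 * (9 / 100))"
      using e_less_272 by simp
    also have "\<dots> = exp 1 ^ 2 * exp (9 / 100) ^ 8"
      using exp_of_nat_mult[of 2 "1 :: real"] exp_of_nat_mult[of 8 "9 / 100 :: real"]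
      unfolding exp_add by simp
    also have "\<dots> \<le> (272 / 100) ^ 2 * (1 + 9 / 100 + (9 / 100)\<^sup>2) ^ 8"
      using e_less_272 exp_bound[of "9 / 100"] by (intro mult_mono power_mono) auto
    also have "\<dots> < 16" by (simp add: power_divide)
    finally show ?thesis .
  qed
  moreover have "15 < exp (exp 1 :: real)"
  proof -
    have e: "2718 / 1000 < exp (1 :: real)"
      using e_approx_32 by (simp add: abs_if split: if_splits)
    \<comment> \<open>The exponent \<open>2 + 64 * (7 / 625)\<close> is 2.7168, just below 2.718;
      with 64 factors, \<open>1 + x \<le> exp x\<close> loses little enough.\<close>
    have "(15::real) < (2718 / 1000) ^ 2 * (1 + 7 / 625) ^ 64"
      by (simp add: power_divide)
    also have "\<dots> \<le> exp 1 ^ 2 * exp (7 / 625) ^ 64"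
      using e exp_ge_add_one_self[of "7 / 625"] by (intro mult_mono power_mono) auto
    also have "\<dots> = exp (2 + 64 * (7 / 625))"
      using exp_of_nat_mult[of 2 "1 :: real"] exp_of_nat_mult[of 64 "7 / 625 :: real"]
      unfolding exp_add by simp
    also have "\<dots> \<le> exp (exp 1)"
      using e by simp
    finally show ?thesis .
  qed
  ultimately have "15 < real n" "real n < 16"
    using n by simp_all
  then have "15 < n" "n < 16" by simp_all
  then show False by simp
qed

theorem theorem1p7:
  fixes \<alpha> :: real
  assumes "\<alpha> > 1"
  shows "\<exists>K::real. K > 0 \<and>
    (\<forall>(D::int) (n::nat) (F :: (nat \<Rightarrow> int) set).
       D > 2 \<longrightarrow> n \<ge> 1 \<longrightarrow> triple_log_defined (real n) \<longrightarrow>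
       F \<subseteq> residue_vectors D n \<longrightarrow> sunflower_free n F \<longrightarrow>
       real (card F) \<le> K * fact n *
         ((ln (ln (ln (real n))))\<^sup>2 / (\<alpha> * ln (ln (real n)))) ^ n)"
proof -
  define q where "q = (\<lambda>n::nat. (ln (ln (ln (real n))))\<^sup>2 / (\<alpha> * ln (ln (real n))))"
  \<comment> \<open>The ratio of the proved bound to the target without its constant. It depends
    only on \<open>n\<close> and \<open>\<alpha>\<close>, so a bound over all \<open>n\<close>
    depends only on \<open>\<alpha>\<close>.\<close>
  define u where "u = (\<lambda>n::nat. (400 * sqrt (real n)) ^ n / (fact n * q n ^ n))"
  have q: "q n > 0" if "n \<ge> 3" for n
    using that assms ln_ln_ln_nat_neq_0[of n] triple_log_defined_nat_iff[of n]
    by (simp add: q_def triple_log_defined_def)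
  have u: "u n \<ge> 0" if "n \<ge> 3" for n
    using q[OF that] by (simp add: u_def)
  \<comment> \<open>Since \<open>fact n \<ge> (n / exp 1) ^ n\<close>, \<open>u n\<close> is at most
    \<open>(400 * exp 1 / (sqrt n * q n)) ^ n\<close>; the denominator tends to infinity, so it
    eventually exceeds \<open>400 * exp 1\<close>.\<close>
  have "filterlim (\<lambda>n::nat. sqrt (real n) * ((ln (ln (ln (real n))))\<^sup>2 / ln (ln (real n)))) at_top at_top"
    by real_asymp
  then have "eventually (\<lambda>n::nat. 400 * exp 1 * \<alpha> \<le> sqrt (real n) * ((ln (ln (ln (real n))))\<^sup>2 / ln (ln (real n)))) at_top"
    by (simp add: filterlim_at_top)
  then obtain N where N: "\<And>n. n \<ge> N \<Longrightarrow>
      400 * exp 1 * \<alpha> \<le> sqrt (real n) * ((ln (ln (ln (real n))))\<^sup>2 / ln (ln (real n)))"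
    by (auto simp: eventually_at_top_linorder)
  have tail: "u n \<le> 1" if n: "n \<ge> N" "n \<ge> 3" for n
  proof -
    have "400 * exp 1 \<le> sqrt (real n) * q n"
    proof -
      have "400 * exp 1 \<le> sqrt (real n) * ((ln (ln (ln (real n))))\<^sup>2 / ln (ln (real n))) / \<alpha>"
        using N[OF n(1)] assms by (subst pos_le_divide_eq) auto
      then show ?thesis by (simp add: q_def mult.commute)
    qed
    then have "sqrt (real n) * (400 * exp 1) \<le> sqrt (real n) * (sqrt (real n) * q n)"
      by (intro mult_left_mono) auto
    then have "400 * sqrt (real n) \<le> (real n / exp 1) * q n"
      by (simp add: field_simps flip: mult.assoc)
    then have "(400 * sqrt (real n)) ^ n \<le> ((real n / exp 1) * q n) ^ n"
      by (intro power_mono) auto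
    also have "\<dots> \<le> fact n * q n ^ n"
      unfolding power_mult_distrib using q[OF n(2)]
      by (intro mult_right_mono power_div_exp_le_fact) auto
    finally show ?thesis using q[OF n(2)] by (simp add: u_def)
  qed
  \<comment> \<open>The 1 covers the tail; the sum absorbs the finitely many earlier
    \<open>n\<close>, its terms being nonnegative.\<close>
  define K where "K = 1 + (\<Sum>n\<in>{3..<N}. u n)"
  have "(\<Sum>n\<in>{3..<N}. u n) \<ge> 0" using u by (intro sum_nonneg) auto
  then have K1: "K \<ge> 1" by (simp add: K_def)
  have uK: "u n \<le> K" if "n \<ge> 3" for n
  proof (cases "n < N")
    case True
    then have "u n \<le> (\<Sum>n\<in>{3..<N}. u n)"
      using u that by (intro member_le_sum) auto
    then show ?thesis by (simp add: K_def)
  qed (use tail[of n] that K1 in auto)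
  show ?thesis
  proof (intro exI[of _ K] conjI allI impI)
    show "K > 0" using K1 by simp
    fix D :: int and n :: nat and F :: "(nat \<Rightarrow> int) set"
    assume n: "n \<ge> 1" "triple_log_defined (real n)"
      and F: "F \<subseteq> residue_vectors D n" "sunflower_free n F" and D: "D > 2"
    have n3: "n \<ge> 3" using n triple_log_defined_nat_iff by blast
    interpret residues D "residue_ring D" by unfold_locales (use D in auto)
    have "finite (residue_vectors D n)"
      unfolding residue_vectors_def by (intro finite_PiE) auto
    then have "finite F" using F(1) by (rule finite_subset[rotated])
    moreover have "F \<subseteq> extensional {1..n}"
      using F(1) by (auto simp: residue_vectors_def PiE_def)
    ultimately have "real (card F) \<le> (400 * sqrt (real n)) ^ n"
      using F(2) n(1) by (intro card_sunflower_free_le_sqrt)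
    also have "\<dots> = u n * (fact n * q n ^ n)"
      using q[OF n3] by (simp add: u_def)
    also have "\<dots> \<le> K * (fact n * q n ^ n)"
      using uK[OF n3] q[OF n3] by (intro mult_right_mono) auto
    finally show "real (card F) \<le> K * fact n *
        ((ln (ln (ln (real n))))\<^sup>2 / (\<alpha> * ln (ln (real n)))) ^ n"
      by (simp add: q_def mult.assoc)
  qed
qed

end
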